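(* Let $N\ge 2$ and let $(S_i)_{i\in\mathbb{Z}_N}$ be a permutative representation of the Cuntz algebra $\mathcal{O}_N$ on a Hilbert space $\mathcal{H}$ with permutative orthonormal basis $\{e_i:i\in I\}$, and assume that the coding map is injective. Suppose $P_M$ is the projection onto a closed subspace $M$ of $\mathcal{H}$ invariant under all $S_l^*$, $l\in\mathbb{Z}_N$. Assume that the following condition is satisfied: there exists $\lambda_0\in I$ such that $$\|P_Me_{\lambda_0}\|=\max\{\|P_Me_i\|:i\in I\}.$$ Then $e_{\lambda_0}$ is in $M$.
   Context: $\mathbb{Z}_N=\{0,1,\dots,N-1\}$. A representation of the Cuntz algebra $\mathcal{O}_N$ on a Hilbert space $\mathcal{H}$ is a family $(S_i)_{i\in\mathbb{Z}_N}$ of bounded operators on $\mathcal{H}$ with $S_i^*S_j=\delta_{ij}I$ for all $i,j$ and $\sum_{i\in\mathbb{Z}_N}S_iS_i^*=I$. The representation is permutative with permutative orthonormal basis $\{e_i:i\in I\}$ if for all $i\in I$, $j\in\mathbb{Z}_N$, $S_je_i$ is an element of this basis; write $S_je_i=e_{\sigma_j(i)}$. The maps $\sigma_j:I\to I$ are injective with disjoint ranges whose union is $I$; let $\sigma:I\to I$ be the map with $\sigma(\sigma_j(i))=i$ for all $j,i$. The coding map $E:I\to\mathcal{K}_N=\mathbb{Z}_N^{\mathbb{N}}$ is $E(i)=j_0j_1j_2\dots$, where $\sigma^k(i)\in\sigma_{j_k}(I)$ for all $k\ge0$.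
   Formalization: The subspace M is additionally assumed to be nonzero; for M = {0} the statement fails, since every index attains the maximum 0 while the unit vector e_{λ0} is not in M. *)

theory Defs
  imports "HOL-Analysis.Analysis"
begin

text \<open>
  A complex Hilbert space carries its underlying real Hilbert space structure, so that norm,
  topology and completeness are the library's; the real inner product is the real part of the
  complex one, which is antilinear in its first argument.
\<close>

class complex_hilbert_space = real_inner + banach +
  fixes scaleC :: "complex \<Rightarrow> 'a \<Rightarrow> 'a" (infixr "*\<^sub>C" 75)
    and cinner :: "'a \<Rightarrow> 'a \<Rightarrow> complex"
  assumes scaleC_add_right: "c *\<^sub>C (x + y) = c *\<^sub>C x + c *\<^sub>C y"
    and scaleC_add_left: "(c + d) *\<^sub>C x = c *\<^sub>C x + d *\<^sub>C x"
    and scaleC_scaleC: "c *\<^sub>C d *\<^sub>C x = (c * d) *\<^sub>C x"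
    and scaleR_scaleC: "r *\<^sub>R x = complex_of_real r *\<^sub>C x"
    and cinner_commute: "cinner x y = cnj (cinner y x)"
    and cinner_add_right: "cinner x (y + z) = cinner x y + cinner x z"
    and cinner_scaleC_right: "cinner x (c *\<^sub>C y) = c * cinner x y"
    and inner_eq_Re_cinner: "inner x y = Re (cinner x y)"

instantiation complex :: complex_hilbert_space
begin

definition scaleC_complex :: "complex \<Rightarrow> complex \<Rightarrow> complex"
  where "scaleC_complex c x = c * x"

definition cinner_complex :: "complex \<Rightarrow> complex \<Rightarrow> complex"
  where "cinner_complex x y = cnj x * y"

instance
  by standard
    (auto simp: scaleC_complex_def cinner_complex_def algebra_simps scaleR_conv_of_real
      inner_complex_def)

end

global_interpretation cvec: vector_space "scaleC :: complex \<Rightarrow> 'a \<Rightarrow> 'a::complex_hilbert_space"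
proof
  show "1 *\<^sub>C x = x" for x :: 'a
    using scaleR_scaleC[of 1 x] by simp
qed (simp_all add: scaleC_add_right scaleC_add_left scaleC_scaleC)

definition bounded_clinear ::
    "('a::complex_hilbert_space \<Rightarrow> 'b::complex_hilbert_space) \<Rightarrow> bool"
  where "bounded_clinear T \<longleftrightarrow> bounded_linear T \<and> (\<forall>c x. T (c *\<^sub>C x) = c *\<^sub>C T x)"

definition cadjoint ::
    "('a::complex_hilbert_space \<Rightarrow> 'b::complex_hilbert_space) \<Rightarrow> 'b \<Rightarrow> 'a"
  where "cadjoint T = (THE T'. \<forall>x y. cinner (T x) y = cinner x (T' y))"

definition orth_proj :: "'a::complex_hilbert_space set \<Rightarrow> 'a \<Rightarrow> 'a"
  where "orth_proj M x = (THE p. p \<in> M \<and> (\<forall>m\<in>M. cinner m (x - p) = 0))"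

definition orthonormal_basis :: "'i set \<Rightarrow> ('i \<Rightarrow> 'a::complex_hilbert_space) \<Rightarrow> bool"
  where "orthonormal_basis I e \<longleftrightarrow>
    (\<forall>i\<in>I. \<forall>j\<in>I. cinner (e i) (e j) = (if i = j then 1 else 0)) \<and>
    closure (cvec.span (e ` I)) = UNIV"

text \<open>\<open>\<int>\<^sub>N\<close> is the set of naturals below \<open>N\<close>; values \<open>S i\<close> for \<open>i \<ge> N\<close> are irrelevant.\<close>

definition cuntz_rep :: "nat \<Rightarrow> (nat \<Rightarrow> 'a::complex_hilbert_space \<Rightarrow> 'a) \<Rightarrow> bool"
  where "cuntz_rep N S \<longleftrightarrow>
    (\<forall>i<N. bounded_clinear (S i)) \<and>
    (\<forall>i<N. \<forall>j<N. \<forall>x. cadjoint (S i) (S j x) = (if i = j then x else 0)) \<and>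
    (\<forall>x. (\<Sum>i<N. S i (cadjoint (S i) x)) = x)"

definition permutative_rep ::
    "nat \<Rightarrow> (nat \<Rightarrow> 'a::complex_hilbert_space \<Rightarrow> 'a) \<Rightarrow> 'i set \<Rightarrow> ('i \<Rightarrow> 'a) \<Rightarrow> bool"
  where "permutative_rep N S I e \<longleftrightarrow>
    cuntz_rep N S \<and> orthonormal_basis I e \<and> (\<forall>i\<in>I. \<forall>j<N. S j (e i) \<in> e ` I)"

text \<open>
  For a permutative representation, the descriptions below determine unique objects at all
  \<open>i \<in> I\<close> and \<open>j < N\<close>: \<open>branch S I e j\<close> is the map \<open>\<sigma>\<^sub>j\<close> and \<open>shift N S I e\<close> is \<open>\<sigma>\<close>.
\<close>

definition branch ::
    "(nat \<Rightarrow> 'a \<Rightarrow> 'a) \<Rightarrow> 'i set \<Rightarrow> ('i \<Rightarrow> 'a) \<Rightarrow> nat \<Rightarrow> 'i \<Rightarrow> 'i"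
  where "branch S I e j i = (THE k. k \<in> I \<and> S j (e i) = e k)"

definition shift ::
    "nat \<Rightarrow> (nat \<Rightarrow> 'a \<Rightarrow> 'a) \<Rightarrow> 'i set \<Rightarrow> ('i \<Rightarrow> 'a) \<Rightarrow> 'i \<Rightarrow> 'i"
  where "shift N S I e k = (THE i. i \<in> I \<and> (\<exists>j<N. branch S I e j i = k))"

definition coding_map ::
    "nat \<Rightarrow> (nat \<Rightarrow> 'a \<Rightarrow> 'a) \<Rightarrow> 'i set \<Rightarrow> ('i \<Rightarrow> 'a) \<Rightarrow> 'i \<Rightarrow> nat \<Rightarrow> nat"
  where "coding_map N S I e i =
    (\<lambda>k. THE j. j < N \<and> (shift N S I e ^^ k) i \<in> branch S I e j ` I)"

end

theory Submission
  imports Defs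
begin

text \<open>
  Let \<open>P\<close> be the projection onto \<open>M\<close>. Invariance of \<open>M\<close> under \<open>S\<^sub>j\<^sup>*\<close> says that \<open>S\<^sub>j\<close> maps the
  orthogonal complement of \<open>M\<close> into itself, so \<open>P S\<^sub>j x = P S\<^sub>j P x\<close> for all \<open>x\<close>. Write an index \<open>m\<close> at
  which \<open>\<parallel>P e\<^sub>m\<parallel>\<close> is maximal as \<open>m = \<sigma>\<^sub>j(m')\<close>. Then
  \<open>\<parallel>P e\<^sub>m\<parallel> = \<parallel>P S\<^sub>j P e\<^sub>m\<^sub>'\<parallel> \<le> \<parallel>S\<^sub>j P e\<^sub>m\<^sub>'\<parallel> = \<parallel>P e\<^sub>m\<^sub>'\<parallel> \<le> \<parallel>P e\<^sub>m\<parallel>\<close>,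
  so equality holds throughout: the maximum is attained at \<open>m'\<close> as well, and \<open>P e\<^sub>m = S\<^sub>j P e\<^sub>m\<^sub>'\<close>
  (lemma \<open>orth_proj_maximal_branch\<close>).

  Hence if \<open>e\<^sub>k\<close> occurs in the expansion of \<open>P e\<^sub>m\<close>, then \<open>k\<close> lies in the range of the same \<open>\<sigma>\<^sub>j\<close>,
  say \<open>k = \<sigma>\<^sub>j(k')\<close>, and \<open>e\<^sub>k\<^sub>'\<close> occurs in the expansion of \<open>P e\<^sub>m\<^sub>'\<close>. The relation between \<open>k\<close> and
  \<open>m\<close> is therefore preserved by the shift and forces equal first digits, so that \<open>k\<close> and \<open>m\<close> have
  the same code (lemma \<open>coding_map_eqI\<close>). Injectivity of the coding map leaves \<open>k = m\<close> only: the
  vector \<open>P e\<^sub>m\<close> is a multiple of \<open>e\<^sub>m\<close>. The multiple is nonzero, because \<open>P\<close> would otherwise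
  vanish on the whole basis, and \<open>P e\<^sub>m\<close> lies in \<open>M\<close>; so \<open>e\<^sub>m\<close> lies in \<open>M\<close>.

  Projections and adjoints are given by definite descriptions, so their defining properties depend
  on existence: the nearest point of a closed subspace provides the projection, and the Riesz
  representation theorem the adjoint.
\<close>

section \<open>The complex inner product\<close>

lemma cinner_add_left: "cinner (x + y) z = cinner x z + cinner y z"
  by (metis cinner_add_right cinner_commute complex_cnj_add)

lemma cinner_scaleC_left: "cinner (c *\<^sub>C x) y = cnj c * cinner x y"
  by (metis cinner_scaleC_right cinner_commute complex_cnj_mult)

lemma cinner_zero_right [simp]: "cinner x 0 = 0"
  using cinner_add_right[of x 0 0] by simp

lemma cinner_zero_left [simp]: "cinner 0 x = 0"
  using cinner_add_left[of 0 0 x] by simp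

lemma cinner_diff_right: "cinner x (y - z) = cinner x y - cinner x z"
  using cinner_add_right[of x "y - z" z] by simp

lemma cinner_diff_left: "cinner (x - y) z = cinner x z - cinner y z"
  using cinner_add_left[of "x - y" y z] by simp

text \<open>
  Both parts of the complex inner product are real inner products. Continuity, boundedness and
  orthogonality are thereby reduced to the real inner product.
\<close>

lemma cinner_eq_inner: "cinner x y = Complex (inner x y) (inner (\<i> *\<^sub>C x) y)"
  by (simp add: complex_eq_iff inner_eq_Re_cinner cinner_scaleC_left)

lemma cinner_self: "cinner x x = complex_of_real ((norm x)\<^sup>2)"
proof -
  have "cnj (cinner x x) = cinner x x"
    by (metis cinner_commute)
  then show ?thesis
    by (simp add: complex_eq_iff power2_norm_eq_inner inner_eq_Re_cinner)
qed

lemma cinner_self_eq_0_iff [simp]: "cinner x x = 0 \<longleftrightarrow> x = 0"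
  by (simp add: cinner_self)

lemma cinner_eq_0_commute: "cinner x y = 0 \<longleftrightarrow> cinner y x = 0"
  by (metis cinner_commute complex_cnj_zero)

lemma norm_eq_if_cinner_self_eq: "cinner x x = cinner y y \<Longrightarrow> norm x = norm y"
  by (metis cinner_self norm_ge_zero of_real_eq_iff power2_eq_imp_eq)

lemma subspace_if_csubspace:
  assumes "cvec.subspace M"
  shows "subspace M"
  using assms unfolding subspace_def cvec.subspace_def by (simp add: scaleR_scaleC)

lemma bounded_clinear_cinner:
  assumes "bounded_clinear T"
  shows "bounded_clinear (\<lambda>x. cinner y (T x))"
proof -
  have T: "bounded_linear T" "\<And>c x. T (c *\<^sub>C x) = c *\<^sub>C T x"
    using assms by (auto simp: bounded_clinear_def)
  have "bounded_linear (\<lambda>x. of_real (inner y (T x)) + \<i> * of_real (inner (\<i> *\<^sub>C y) (T x)))"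
    by (intro bounded_linear_add bounded_linear_const_mult bounded_linear_compose[OF bounded_linear_of_real]
        bounded_linear_compose[OF bounded_linear_inner_right] T(1))
  then show ?thesis
    by (simp add: bounded_clinear_def T(2) cinner_scaleC_right scaleC_complex_def
        flip: cinner_eq_inner Complex_eq)
qed

section \<open>Orthogonal projections and adjoints\<close>

text \<open>
  By the parallelogram law, two points of \<open>M\<close> that both nearly attain the distance from \<open>x\<close> are
  close to each other, because their midpoint cannot be nearer to \<open>x\<close> than the infimum. A
  minimizing sequence is thus Cauchy, and its limit is the nearest point.
\<close>

lemma ex_nearest_point_in_subspace:
  fixes M :: "'a::{real_inner,banach} set"
  assumes "closed M" "subspace M"
  shows "\<exists>p\<in>M. \<forall>m\<in>M. norm (x - p) \<le> norm (x - m)"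
proof -
  define D where "D = Inf ((\<lambda>m. (norm (x - m))\<^sup>2) ` M)"
  have ne: "M \<noteq> {}" and bdd: "bdd_below ((\<lambda>m. (norm (x - m))\<^sup>2) ` M)"
    using assms(2) subspace_0 by (auto intro!: bdd_belowI[of _ 0])
  have D: "D \<le> (norm (x - m))\<^sup>2" if "m \<in> M" for m
    unfolding D_def using bdd that by (intro cInf_lower) auto
  have "\<exists>m\<in>M. (norm (x - m))\<^sup>2 < D + 1 / real (Suc n)" for n
    using cInf_lessD[of "(\<lambda>m. (norm (x - m))\<^sup>2) ` M" "D + 1 / real (Suc n)"] ne
    by (auto simp: D_def)
  then obtain y where yM: "\<And>n. y n \<in> M"
    and y: "\<And>n. (norm (x - y n))\<^sup>2 < D + 1 / real (Suc n)"
    by metis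
  have close: "(norm (y m - y n))\<^sup>2 \<le> 2 / real (Suc m) + 2 / real (Suc n)" for m n
  proof -
    have "(1/2) *\<^sub>R (y m + y n) \<in> M"
      using yM assms(2) by (intro subspace_scale subspace_add)
    then have "D \<le> (norm (x - (1/2) *\<^sub>R (y m + y n)))\<^sup>2"
      by (rule D)
    moreover have "(norm (y m - y n))\<^sup>2 = 2 * (norm (x - y m))\<^sup>2 + 2 * (norm (x - y n))\<^sup>2
        - 4 * (norm (x - (1/2) *\<^sub>R (y m + y n)))\<^sup>2"
      by (simp add: power2_norm_eq_inner inner_diff_left inner_diff_right inner_add_left
          inner_add_right inner_commute algebra_simps)
    ultimately show ?thesis
      using y[of m] y[of n] by simp
  qed
  have "Cauchy y"
  proof (rule metric_CauchyI)
    fix \<epsilon> :: real assume "\<epsilon> > 0"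
    then obtain K where K: "inverse (real (Suc K)) < \<epsilon>\<^sup>2 / 4"
      using reals_Archimedean[of "\<epsilon>\<^sup>2 / 4"] by auto
    have "dist (y m) (y n) < \<epsilon>" if "m \<ge> K" "n \<ge> K" for m n
    proof -
      have "1 / real (Suc m) \<le> inverse (real (Suc K))" "1 / real (Suc n) \<le> inverse (real (Suc K))"
        using that by (auto simp: field_simps)
      then have "(norm (y m - y n))\<^sup>2 < \<epsilon>\<^sup>2"
        using close[of m n] K by simp
      then show ?thesis
        using \<open>\<epsilon> > 0\<close> by (simp add: dist_norm power2_less_imp_less)
    qed
    then show "\<exists>K. \<forall>m\<ge>K. \<forall>n\<ge>K. dist (y m) (y n) < \<epsilon>"
      by blast
  qed
  then obtain p where p: "y \<longlonglongrightarrow> p"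
    using Cauchy_convergent convergent_def by blast
  have "p \<in> M"
    using closed_sequentially[OF assms(1)] yM p by blast
  have "(\<lambda>n. (norm (x - y n))\<^sup>2) \<longlonglongrightarrow> (norm (x - p))\<^sup>2"
    by (intro tendsto_intros p)
  moreover have "(\<lambda>n. D + 1 / real (Suc n)) \<longlonglongrightarrow> D + 0"
    by (intro tendsto_add tendsto_const LIMSEQ_Suc lim_1_over_n)
  ultimately have "(norm (x - p))\<^sup>2 \<le> D + 0"
    by (rule LIMSEQ_le) (use y in \<open>auto intro!: less_imp_le\<close>)
  then show ?thesis
    using \<open>p \<in> M\<close> D unfolding add_0_right by (meson norm_ge_zero order_trans power2_le_imp_le)
qed

lemma nearest_point_orthogonal:
  fixes M :: "'a::real_inner set"
  assumes "subspace M" "p \<in> M" "\<And>m. m \<in> M \<Longrightarrow> norm (x - p) \<le> norm (x - m)" "m \<in> M"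
  shows "inner m (x - p) = 0"
proof (cases "m = 0")
  case False
  \<comment> \<open>The step along \<open>m\<close> that minimizes the distance from \<open>x\<close> on the line through \<open>p\<close>.\<close>
  define t where "t = inner m (x - p) / inner m m"
  have "norm (x - p) \<le> norm (x - (p + t *\<^sub>R m))"
    using assms by (intro assms(3) subspace_add subspace_scale)
  then have "(norm (x - p))\<^sup>2 \<le> (norm ((x - p) - t *\<^sub>R m))\<^sup>2"
    by (simp add: diff_diff_eq)
  also have "\<dots> = (norm (x - p))\<^sup>2 - 2 * t * inner m (x - p) + t\<^sup>2 * inner m m"
    unfolding power2_norm_eq_inner
    by (simp add: inner_diff_left inner_diff_right inner_commute power2_eq_square[of t]
        algebra_simps)
  also have "\<dots> = (norm (x - p))\<^sup>2 - (inner m (x - p))\<^sup>2 / inner m m"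
    using False by (simp add: t_def power2_eq_square field_simps)
  finally have "(inner m (x - p))\<^sup>2 / inner m m \<le> 0"
    by simp
  moreover have "inner m m > 0"
    using False by simp
  ultimately show ?thesis
    by (simp add: divide_le_0_iff)
qed simp

lemma orth_proj_eqI:
  assumes "cvec.subspace M" "p \<in> M" "\<And>m. m \<in> M \<Longrightarrow> cinner m (x - p) = 0"
  shows "orth_proj M x = p"
  unfolding orth_proj_def
proof (rule the_equality)
  fix q assume q: "q \<in> M \<and> (\<forall>m\<in>M. cinner m (x - q) = 0)"
  have "q - p \<in> M"
    using assms q by (auto intro: cvec.subspace_diff)
  then have "cinner (q - p) ((x - p) - (x - q)) = 0"
    using assms q by (simp add: cinner_diff_right)
  then show "q = p"
    by (simp add: algebra_simps)
qed (use assms in auto)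

context
  fixes M :: "'a::complex_hilbert_space set"
  assumes M: "closed M" "cvec.subspace M"
begin

lemma orth_proj_props:
  shows orth_proj_mem: "orth_proj M x \<in> M"
    and orth_proj_orth: "m \<in> M \<Longrightarrow> cinner m (x - orth_proj M x) = 0"
proof -
  obtain p where p: "p \<in> M" "\<And>m. m \<in> M \<Longrightarrow> norm (x - p) \<le> norm (x - m)"
    using ex_nearest_point_in_subspace[OF M(1) subspace_if_csubspace[OF M(2)]] by blast
  \<comment> \<open>Since \<open>M\<close> is a complex subspace, \<open>x - p\<close> is real-orthogonal to \<open>\<i> m\<close> too, which accounts for
    the imaginary part.\<close>
  have 0: "cinner m (x - p) = 0" if "m \<in> M" for m
  proof -
    have "inner m (x - p) = 0" "inner (\<i> *\<^sub>C m) (x - p) = 0"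
      using that p M(2) by (auto intro!: nearest_point_orthogonal[OF subspace_if_csubspace[OF M(2)]]
          cvec.subspace_scale)
    then show ?thesis
      by (simp add: cinner_eq_inner Complex_eq_0)
  qed
  then have "orth_proj M x = p"
    using M(2) p(1) by (intro orth_proj_eqI)
  then show "orth_proj M x \<in> M" "m \<in> M \<Longrightarrow> cinner m (x - orth_proj M x) = 0"
    using p 0 by auto
qed

lemma cinner_orth_proj:
  assumes "m \<in> M"
  shows "cinner m (orth_proj M x) = cinner m x"
  using orth_proj_orth[OF assms, of x] by (simp add: cinner_diff_right)

lemma norm_orth_proj_pythagoras:
  "(norm x)\<^sup>2 = (norm (orth_proj M x))\<^sup>2 + (norm (x - orth_proj M x))\<^sup>2"
proof -
  have "inner (orth_proj M x) (x - orth_proj M x) = 0"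
    by (simp add: inner_eq_Re_cinner orth_proj_orth orth_proj_mem)
  then show ?thesis
    by (simp add: power2_norm_eq_inner inner_diff_left inner_diff_right inner_commute)
qed

lemma norm_orth_proj_le: "norm (orth_proj M x) \<le> norm x"
  using norm_orth_proj_pythagoras[of x] by (simp add: power2_le_imp_le)

lemma orth_proj_eq_self_if_norm_le:
  assumes "norm x \<le> norm (orth_proj M x)"
  shows "orth_proj M x = x"
  using norm_orth_proj_pythagoras[of x] assms norm_orth_proj_le[of x] by simp

end

text \<open>
  If \<open>f \<noteq> 0\<close>, the component \<open>w\<close> of some vector orthogonal to the kernel of \<open>f\<close> is nonzero. Since
  \<open>x - (f x / f w) w\<close> lies in the kernel, pairing with \<open>w\<close> recovers \<open>f x\<close> up to a constant factor.
\<close>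

lemma riesz_representation:
  fixes f :: "'a::complex_hilbert_space \<Rightarrow> complex"
  assumes "bounded_clinear f"
  shows "\<exists>z. \<forall>x. f x = cinner z x"
proof (cases "\<forall>x. f x = 0")
  case True
  then show ?thesis
    by (auto intro!: exI[of _ 0])
next
  case False
  then obtain u where u: "f u \<noteq> 0"
    by blast
  interpret f: bounded_linear f
    using assms by (simp add: bounded_clinear_def)
  have fC: "f (c *\<^sub>C x) = c * f x" for c x
    using assms by (simp add: bounded_clinear_def scaleC_complex_def)
  define K where "K = {x. f x = 0}"
  have K: "closed K" "cvec.subspace K"
    unfolding K_def cvec.subspace_def
    by (auto simp: f.zero f.add fC intro!: closed_Collect_eq f.continuous_on continuous_on_id)
  define w where "w = u - orth_proj K u"
  have fw: "f w = f u"
    using orth_proj_mem[OF K, of u] by (simp add: w_def f.diff K_def)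
  then have "w \<noteq> 0"
    using u f.zero by auto
  define z where "z = cnj (f w / cinner w w) *\<^sub>C w"
  have "f x = cinner z x" for x
  proof -
    have "x - (f x / f w) *\<^sub>C w \<in> K"
      using fw u by (simp add: K_def f.diff fC)
    then have "cinner (x - (f x / f w) *\<^sub>C w) w = 0"
      unfolding w_def by (rule orth_proj_orth[OF K])
    then have "cinner w (x - (f x / f w) *\<^sub>C w) = 0"
      by (simp add: cinner_eq_0_commute)
    then have "cinner w x = (f x / f w) * cinner w w"
      by (simp add: cinner_diff_right cinner_scaleC_right)
    then show ?thesis
      using \<open>w \<noteq> 0\<close> fw u by (simp add: z_def cinner_scaleC_left)
  qed
  then show ?thesis
    by blast
qed

lemma cinner_cadjoint:
  fixes T :: "'a::complex_hilbert_space \<Rightarrow> 'b::complex_hilbert_space"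
  assumes "bounded_clinear T"
  shows "cinner (T x) y = cinner x (cadjoint T y)"
proof -
  have "\<exists>z. \<forall>x. cinner y (T x) = cinner z x" for y
    using riesz_representation[OF bounded_clinear_cinner[OF assms]] .
  then obtain T' where "\<And>x y. cinner y (T x) = cinner (T' y) x"
    by metis
  then have T': "\<forall>x y. cinner (T x) y = cinner x (T' y)"
    by (metis cinner_commute)
  have "cadjoint T = T'"
    unfolding cadjoint_def
  proof (rule the_equality)
    fix T'' assume "\<forall>x y. cinner (T x) y = cinner x (T'' y)"
    with T' have "cinner x (T'' y - T' y) = 0" for x y
      by (simp add: cinner_diff_right)
    then show "T'' = T'"
      by (metis cinner_self_eq_0_iff eq_iff_diff_eq_0 ext)
  qed (fact T')
  with T' show ?thesis
    by simp
qed

text \<open>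
  The real orthogonal complement of \<open>w\<close> is closed and contains the span of the basis, so it is the
  whole space and contains \<open>w\<close> itself.
\<close>

lemma orthogonal_to_basis_imp_0:
  assumes "orthonormal_basis I e" "\<And>i. i \<in> I \<Longrightarrow> cinner (e i) w = 0"
  shows "w = 0"
proof -
  have "cvec.subspace {x. cinner x w = 0}"
    by (auto simp: cvec.subspace_def cinner_add_left cinner_scaleC_left)
  then have "cvec.span (e ` I) \<subseteq> {x. cinner x w = 0}"
    using assms(2) by (intro cvec.span_minimal) auto
  also have "\<dots> \<subseteq> {x. inner x w = 0}"
    by (auto simp: inner_eq_Re_cinner)
  finally have "closure (cvec.span (e ` I)) \<subseteq> {x. inner x w = 0}"
    by (rule closure_minimal) (intro closed_Collect_eq continuous_intros)
  moreover have "closure (cvec.span (e ` I)) = UNIV"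
    using assms(1) by (simp only: orthonormal_basis_def)
  ultimately have "w \<in> {x. inner x w = 0}"
    by blast
  then show ?thesis
    by simp
qed

section \<open>Permutative representations\<close>

context
  fixes N :: nat and S :: "nat \<Rightarrow> 'a::complex_hilbert_space \<Rightarrow> 'a"
    and I :: "'i set" and e :: "'i \<Rightarrow> 'a"
  assumes perm: "permutative_rep N S I e"
begin

lemma S_clinear: "j < N \<Longrightarrow> bounded_clinear (S j)"
  and S_orth: "l < N \<Longrightarrow> j < N \<Longrightarrow> cadjoint (S l) (S j x) = (if l = j then x else 0)"
  and S_sum: "(\<Sum>j<N. S j (cadjoint (S j) x)) = x"
  and onb: "orthonormal_basis I e"
  and S_basis: "i \<in> I \<Longrightarrow> j < N \<Longrightarrow> S j (e i) \<in> e ` I"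
  using perm by (auto simp: permutative_rep_def cuntz_rep_def)

lemma cinner_basis: "i \<in> I \<Longrightarrow> k \<in> I \<Longrightarrow> cinner (e i) (e k) = (if i = k then 1 else 0)"
  using onb by (auto simp: orthonormal_basis_def)

lemma norm_S: "j < N \<Longrightarrow> norm (S j x) = norm x"
  by (intro norm_eq_if_cinner_self_eq) (simp add: cinner_cadjoint[OF S_clinear] S_orth)

lemma basis_nonzero: "i \<in> I \<Longrightarrow> e i \<noteq> 0"
  using cinner_basis[of i i] by auto

lemma basis_inj: "i \<in> I \<Longrightarrow> k \<in> I \<Longrightarrow> e i = e k \<Longrightarrow> i = k"
  using cinner_basis[of i i] cinner_basis[of i k] by (auto split: if_splits)

lemma branch_props:
  assumes "i \<in> I" "j < N"
  shows branch_mem: "branch S I e j i \<in> I"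
    and basis_branch: "e (branch S I e j i) = S j (e i)"
proof -
  have "\<exists>!k. k \<in> I \<and> S j (e i) = e k"
    using S_basis[OF assms] basis_inj by auto
  from theI'[OF this] show "branch S I e j i \<in> I" "e (branch S I e j i) = S j (e i)"
    by (auto simp: branch_def)
qed

lemma cadjoint_branch:
  assumes "k \<in> I" "j < N" "l < N"
  shows "cadjoint (S l) (e (branch S I e j k)) = (if l = j then e k else 0)"
  using assms by (simp add: basis_branch S_orth)

lemma branch_eq_iff:
  assumes "i \<in> I" "k \<in> I" "j < N" "l < N"
  shows "branch S I e j i = branch S I e l k \<longleftrightarrow> j = l \<and> i = k"
  using cadjoint_branch[of i j j] cadjoint_branch[of k l j] assms basis_nonzero basis_inj
  by (metis (full_types))

text \<open>
  The ranges of the \<open>\<sigma>\<^sub>j\<close> cover \<open>I\<close>: as the projections \<open>S\<^sub>j S\<^sub>j\<^sup>*\<close> sum to the identity, some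
  \<open>S\<^sub>j\<^sup>* e\<^sub>i\<close> is nonzero and has a nonzero coefficient at some \<open>e\<^sub>k\<close>. That coefficient is the inner
  product of the basis vectors \<open>S\<^sub>j e\<^sub>k\<close> and \<open>e\<^sub>i\<close>, which must therefore be equal.
\<close>

lemma ex_branch:
  assumes "i \<in> I"
  shows "\<exists>j<N. \<exists>k\<in>I. branch S I e j k = i"
proof -
  have "\<exists>j<N. cadjoint (S j) (e i) \<noteq> 0"
  proof (rule ccontr)
    assume "\<not> ?thesis"
    moreover have "S j 0 = 0" if "j < N" for j
      using norm_S[OF that, of 0] by simp
    ultimately have "(\<Sum>j<N. S j (cadjoint (S j) (e i))) = 0"
      by (intro sum.neutral) auto
    then show False
      using S_sum[of "e i"] basis_nonzero[OF assms] by simp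
  qed
  then obtain j where j: "j < N" "cadjoint (S j) (e i) \<noteq> 0"
    by blast
  then obtain k where k: "k \<in> I" "cinner (e k) (cadjoint (S j) (e i)) \<noteq> 0"
    using orthogonal_to_basis_imp_0[OF onb] by blast
  then have "cinner (e (branch S I e j k)) (e i) \<noteq> 0"
    using j(1) by (simp add: cinner_cadjoint[OF S_clinear] basis_branch)
  then show ?thesis
    using cinner_basis[OF branch_mem[OF k(1) j(1)] assms] j(1) k(1) by (auto split: if_splits)
qed

lemma shift_branch:
  assumes "k \<in> I" "j < N"
  shows "shift N S I e (branch S I e j k) = k"
  unfolding shift_def using assms by (intro the_equality) (auto simp: branch_eq_iff)

lemma shift_mem: "i \<in> I \<Longrightarrow> shift N S I e i \<in> I"
  using ex_branch shift_branch by metis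

text \<open>
  Coinduction on the sequence of digits: the hypothesis makes \<open>R\<close> a bisimulation for the shift.
\<close>

lemma coding_map_eqI:
  assumes R: "R k m"
    and step: "\<And>k m. R k m \<Longrightarrow> \<exists>j<N. \<exists>k'\<in>I. \<exists>m'\<in>I.
      k = branch S I e j k' \<and> m = branch S I e j m' \<and> R k' m'"
  shows "coding_map N S I e k = coding_map N S I e m"
proof
  fix n
  have "R ((shift N S I e ^^ n) k) ((shift N S I e ^^ n) m)"
  proof (induction n)
    case (Suc n)
    then show ?case
      using step[OF Suc] by (auto simp: shift_branch)
  qed (simp add: R)
  from step[OF this] obtain j k' m' where j: "j < N" "k' \<in> I" "m' \<in> I"
    and eq: "(shift N S I e ^^ n) k = branch S I e j k'"
      "(shift N S I e ^^ n) m = branch S I e j m'"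
    by blast
  have "l < N \<and> branch S I e j i \<in> branch S I e l ` I \<longleftrightarrow> l = j" if "i \<in> I" for l i
    using that j(1) by (auto simp: branch_eq_iff)
  then show "coding_map N S I e k n = coding_map N S I e m n"
    using j by (simp add: coding_map_def eq)
qed

text \<open>
  The difference of the two sides inside \<open>P\<close> is \<open>S\<^sub>j\<close> applied to a vector orthogonal to \<open>M\<close>, and
  moving \<open>S\<^sub>j\<close> across the inner product with an element of \<open>M\<close> stays in \<open>M\<close> by invariance.
\<close>

lemma orth_proj_S:
  assumes M: "closed M" "cvec.subspace M" and inv: "\<And>x. x \<in> M \<Longrightarrow> cadjoint (S j) x \<in> M"
    and j: "j < N"
  shows "orth_proj M (S j (orth_proj M x)) = orth_proj M (S j x)"
proof (rule orth_proj_eqI[OF M(2) orth_proj_mem[OF M]])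
  fix m assume m: "m \<in> M"
  have move: "cinner m (S j y) = cinner (cadjoint (S j) m) y" for y
    by (metis cinner_cadjoint[OF S_clinear[OF j]] cinner_commute)
  show "cinner m (S j (orth_proj M x) - orth_proj M (S j x)) = 0"
    by (simp add: cinner_diff_right cinner_orth_proj[OF M] m move inv)
qed

text \<open>
  Under the hypothesis on the norms, projecting \<open>S\<^sub>j P x\<close> does not shorten it, and a vector that is
  not shortened by \<open>P\<close> already lies in \<open>M\<close>.
\<close>

lemma orth_proj_maximal_branch:
  assumes M: "closed M" "cvec.subspace M" and inv: "\<And>x. x \<in> M \<Longrightarrow> cadjoint (S j) x \<in> M"
    and j: "j < N" and le: "norm (orth_proj M x) \<le> norm (orth_proj M (S j x))"
  shows "orth_proj M (S j x) = S j (orth_proj M x)"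
  using orth_proj_eq_self_if_norm_le[OF M, of "S j (orth_proj M x)"] le
  by (simp add: orth_proj_S[OF M inv j] norm_S[OF j])

end

theorem theorem4p15:
  fixes N :: nat
    and S :: "nat \<Rightarrow> 'a::complex_hilbert_space \<Rightarrow> 'a"
    and I :: "'i set"
    and e :: "'i \<Rightarrow> 'a"
    and M :: "'a set"
    and i\<^sub>0 :: 'i
  assumes "N \<ge> 2"
    and "permutative_rep N S I e"
    and "inj_on (coding_map N S I e) I"
    and "closed M" and "cvec.subspace M" and "M \<noteq> {0}"
    and "\<And>l x. l < N \<Longrightarrow> x \<in> M \<Longrightarrow> cadjoint (S l) x \<in> M"
    and "i\<^sub>0 \<in> I"
    and "\<And>i. i \<in> I \<Longrightarrow> norm (orth_proj M (e i)) \<le> norm (orth_proj M (e i\<^sub>0))"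
  shows "e i\<^sub>0 \<in> M"
proof -
  note perm = assms(2) and M = assms(4,5)
  define P where "P = orth_proj M"
  define w where "w = P (e i\<^sub>0)"
  have "w \<noteq> 0"
  proof
    assume "w = 0"
    then have P0: "P (e i) = 0" if "i \<in> I" for i
      using assms(9)[OF that] by (simp add: w_def P_def)
    have "m = 0" if "m \<in> M" for m
    proof (rule orthogonal_to_basis_imp_0[OF onb[OF perm]])
      fix i assume "i \<in> I"
      then have "cinner m (e i) = 0"
        using cinner_orth_proj[OF M that, of "e i"] P0 by (simp add: P_def)
      then show "cinner (e i) m = 0"
        by (simp add: cinner_eq_0_commute)
    qed
    then show False
      using assms(5,6) cvec.subspace_0 by blast
  qed
  \<comment> \<open>\<open>e\<^sub>k\<close> occurs in the expansion of \<open>P e\<^sub>m\<close>, where \<open>m\<close> is again an index of maximal norm.\<close>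
  define R where "R k m \<longleftrightarrow> k \<in> I \<and> m \<in> I \<and> norm (P (e m)) = norm w \<and> cinner (e k) (P (e m)) \<noteq> 0"
    for k m
  have step: "\<exists>j<N. \<exists>k'\<in>I. \<exists>m'\<in>I.
      k = branch S I e j k' \<and> m = branch S I e j m' \<and> R k' m'" if "R k m" for k m
  proof -
    have R: "k \<in> I" "m \<in> I" "norm (P (e m)) = norm w" "cinner (e k) (P (e m)) \<noteq> 0"
      using that by (auto simp: R_def)
    obtain j m' where m': "j < N" "m' \<in> I" "m = branch S I e j m'"
      using ex_branch[OF perm R(2)] by blast
    obtain l k' where k': "l < N" "k' \<in> I" "k = branch S I e l k'"
      using ex_branch[OF perm R(1)] by blast
    have em: "e m = S j (e m')" and ek: "e k = S l (e k')"
      using m' k' by (auto simp: basis_branch[OF perm])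
    have le: "norm (P (e m')) \<le> norm w"
      using assms(9)[OF m'(2)] by (simp add: w_def P_def)
    have Pm: "P (e m) = S j (P (e m'))"
      unfolding P_def em
      using le R(3) by (intro orth_proj_maximal_branch[OF perm M assms(7)[OF m'(1)] m'(1)])
        (simp_all add: P_def em)
    \<comment> \<open>\<open>S\<^sub>l\<^sup>* S\<^sub>j = 0\<close> for \<open>l \<noteq> j\<close>, so a nonzero coefficient forces equal first digits.\<close>
    have "cinner (e k) (P (e m)) = cinner (e k') (cadjoint (S l) (S j (P (e m'))))"
      by (simp add: ek Pm cinner_cadjoint[OF S_clinear[OF perm k'(1)]])
    also have "\<dots> = (if l = j then cinner (e k') (P (e m')) else 0)"
      by (simp add: S_orth[OF perm k'(1) m'(1)])
    finally have "l = j" "cinner (e k') (P (e m')) \<noteq> 0"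
      using R(4) by (auto split: if_splits)
    moreover have "norm (P (e m')) = norm w"
      using R(3) by (simp add: Pm norm_S[OF perm m'(1)])
    ultimately show ?thesis
      using m' k' by (auto simp: R_def)
  qed
  have coeff: "cinner (e k) w = 0" if "k \<in> I" "k \<noteq> i\<^sub>0" for k
  proof (rule ccontr)
    assume "cinner (e k) w \<noteq> 0"
    then have "R k i\<^sub>0"
      using that assms(8) by (simp add: R_def w_def)
    then have "coding_map N S I e k = coding_map N S I e i\<^sub>0"
      using step by (rule coding_map_eqI[OF perm])
    then show False
      using assms(3,8) that by (auto dest: inj_onD)
  qed
  define c where "c = cinner (e i\<^sub>0) w"
  have "w - c *\<^sub>C e i\<^sub>0 = 0"
  proof (rule orthogonal_to_basis_imp_0[OF onb[OF perm]])
    fix k assume "k \<in> I"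
    then show "cinner (e k) (w - c *\<^sub>C e i\<^sub>0) = 0"
      using coeff[of k] assms(8)
      by (auto simp: cinner_diff_right cinner_scaleC_right cinner_basis[OF perm] c_def)
  qed
  then have w: "w = c *\<^sub>C e i\<^sub>0"
    by simp
  with \<open>w \<noteq> 0\<close> have "e i\<^sub>0 = inverse c *\<^sub>C w"
    by auto
  moreover have "w \<in> M"
    unfolding w_def P_def by (rule orth_proj_mem[OF M])
  ultimately show ?thesis
    using cvec.subspace_scale[OF M(2)] by simp
qed

end
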